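(* Let $a\in\mathbb{R}^k$, $A\in\mathbb{R}^{k\times d}$, $A'\in\mathbb{R}^{k\times m}$, $b\in\mathbb{R}^l$, $B\in\mathbb{R}^{l\times d}$, $B'\in\mathbb{R}^{l\times n}$, and let $$\pi(P_A)=\{x\in\mathbb{R}^d \mid \exists y\in\mathbb{R}^m:\ a+Ax+A'y\ge 0\},\qquad \pi(P_B)=\{x\in\mathbb{R}^d\mid \exists y'\in\mathbb{R}^n:\ b+Bx+B'y'\ge 0\}.$$ Assume that $\pi(P_A)$ is nonempty. (1) $\pi(P_A)\subseteq\pi(P_B)$ if and only if $z^T(b+Bx)\ge 0$ for all $(x,z)\in \pi(P_A)\times\left(\ker(B'^T)\cap\mathbb{R}^l_+\right)$. (2) Assume $\ker(B'^T)\cap\mathbb{R}^l_+\neq\{0\}$. Then $\pi(P_A)\subseteq\pi(P_B)$ if and only if $z^T(b+Bx)\ge 0$ for all $(x,z)\in\pi(P_A)\times\left(\ker(B'^T)\cap\Delta^l\right)$.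
   Context: $\mathbb{R}^l_+$ denotes the set of entrywise nonnegative vectors in $\mathbb{R}^l$, $\Delta^l=\{z\in\mathbb{R}^l \mid \mathbf{1}_l^Tz=1,\ z\ge 0\}$ is the $l$-simplex, where $\mathbf{1}_l$ is the all-ones vector, and vector inequalities are entrywise. Note that $\ker(B'^T)$ is the orthogonal complement of the column span of $B'$. *)

theory Defs
  imports "Jordan_Normal_Form.Matrix_Kernel"
begin

text \<open>
  Vectors and matrices carry their dimensions explicitly, so that all dimensions, including
  zero, are covered. The order on vectors is the library's entrywise one.
\<close>

definition projected_polyhedron :: "real vec \<Rightarrow> real mat \<Rightarrow> real mat \<Rightarrow> real vec set" where
  "projected_polyhedron a A A' =
     {x \<in> carrier_vec (dim_col A).
        \<exists>y \<in> carrier_vec (dim_col A'). 0\<^sub>v (dim_vec a) \<le> a + A *\<^sub>v x + A' *\<^sub>v y}"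

definition nonneg_orthant :: "nat \<Rightarrow> real vec set" where
  "nonneg_orthant l = {z \<in> carrier_vec l. 0\<^sub>v l \<le> z}"

definition std_simplex :: "nat \<Rightarrow> real vec set" where
  "std_simplex l = {z \<in> carrier_vec l. vec l (\<lambda>_. 1) \<bullet> z = 1 \<and> 0\<^sub>v l \<le> z}"

end

theory Submission
  imports Defs
begin

text \<open>
  Fix \<open>x\<close> and put \<open>c = b + B x\<close>. Membership of \<open>x\<close> in the projection asks whether the system
  \<open>0 \<le> c + B' y\<close> is solvable in \<open>y\<close>. Whenever \<open>z \<ge> 0\<close> annihilates the columns of \<open>B'\<close>, pairing
  the system with \<open>z\<close> removes \<open>y\<close> and leaves the necessary condition \<open>0 \<le> z \<bullet> c\<close>. Gale's theorem
  of the alternative (lemma \<open>gale_alternative\<close>) says that these conditions are also sufficient, so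
  the first equivalence is Gale's theorem applied at every \<open>x\<close> of the first projection.

  Sufficiency is Fourier-Motzkin elimination, carried out in lemma \<open>fourier_motzkin\<close> on the
  multipliers rather than on the inequalities: every inequality derived during the elimination is
  \<open>0 \<le> w \<bullet> (c + B' y)\<close> for some \<open>w\<close> in the nonnegative orthant, so the whole procedure can be
  described by a finite set of multipliers \<open>w\<close> lying in a cone. Eliminating a variable intersects
  the cone with the hyperplane orthogonal to the corresponding column of \<open>B'\<close>.

  For the second equivalence, the condition on \<open>z\<close> is invariant under positive scaling and trivial
  at \<open>z = 0\<close>, and every nonzero element of the orthant is a positive multiple of an element of the
  simplex.
\<close>

section \<open>Fourier-Motzkin elimination on multipliers\<close>

text \<open>
  The final step of an elimination: the eliminated variable occurs with its positive coefficients
  \<open>g p\<close> in lower bounds and with its negative coefficients \<open>g q\<close> in upper bounds. In dimension one,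
  finitely many lower and upper bounds are compatible as soon as they are so pairwise.
\<close>

lemma exists_common_solution_of_bounds:
  fixes f g :: "'a \<Rightarrow> real"
  assumes "finite W"
    and zero: "\<And>w. w \<in> W \<Longrightarrow> g w = 0 \<Longrightarrow> 0 \<le> f w"
    and pairs: "\<And>p q. p \<in> W \<Longrightarrow> q \<in> W \<Longrightarrow> 0 < g p \<Longrightarrow> g q < 0 \<Longrightarrow> 0 \<le> g p * f q - g q * f p"
  shows "\<exists>t. \<forall>w\<in>W. 0 \<le> f w + t * g w"
proof -
  define L where "L = (\<lambda>w. - f w / g w) ` {w \<in> W. 0 < g w}"
  define U where "U = (\<lambda>w. - f w / g w) ` {w \<in> W. g w < 0}"
  have fin: "finite L" "finite U"
    using \<open>finite W\<close> by (auto simp: L_def U_def)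
  have LU: "s \<le> u" if "s \<in> L" "u \<in> U" for s u
  proof -
    obtain p where p: "p \<in> W" "0 < g p" "f p = - (s * g p)"
      using \<open>s \<in> L\<close> by (auto simp: L_def)
    obtain q where q: "q \<in> W" "g q < 0" "f q = - (u * g q)"
      using \<open>u \<in> U\<close> by (auto simp: U_def)
    have "(u - s) * (g p * - g q) = g p * f q - g q * f p"
      using p q by (simp add: algebra_simps)
    then have "0 \<le> (u - s) * (g p * - g q)"
      using pairs[of p q] p q by simp
    moreover have "0 < g p * - g q"
      using p q by (intro mult_pos_pos) auto
    ultimately show ?thesis
      by (simp only: zero_le_mult_iff) auto
  qed
  have "\<exists>t. (\<forall>s\<in>L. s \<le> t) \<and> (\<forall>u\<in>U. t \<le> u)"
  proof (cases "L = {}")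
    case True
    show ?thesis
    proof (cases "U = {}")
      case False
      then show ?thesis using True fin by (intro exI[of _ "Min U"]) auto
    qed (use True in auto)
  next
    case False
    then show ?thesis using fin LU by (intro exI[of _ "Max L"]) auto
  qed
  then obtain t where t: "\<And>s. s \<in> L \<Longrightarrow> s \<le> t" "\<And>u. u \<in> U \<Longrightarrow> t \<le> u"
    by blast
  have "0 \<le> f w + t * g w" if "w \<in> W" for w
  proof -
    consider "g w = 0" | "0 < g w" | "g w < 0" by linarith
    then show ?thesis
    proof cases
      case 1
      then show ?thesis using zero that by simp
    next
      case 2
      then have "- f w / g w \<le> t" using t(1) that by (auto simp: L_def)
      with 2 show ?thesis by (simp add: field_simps)
    next
      case 3
      then have "t \<le> - f w / g w" using t(2) that by (auto simp: U_def)
      with 3 show ?thesis by (simp add: field_simps)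
    qed
  qed
  then show ?thesis by blast
qed

text \<open>
  Allowing an arbitrary cone \<open>K\<close> of multipliers is what makes the induction on the number of
  variables work: the combinations \<open>(p \<bullet> g n) q - (q \<bullet> g n) p\<close> that eliminate the last variable
  \<open>y n\<close> have nonnegative coefficients and hence lie in the smaller cone of those elements of \<open>K\<close>
  that are orthogonal to \<open>g n\<close>, and the hypothesis passes to that cone by restriction.
\<close>

lemma fourier_motzkin:
  fixes c :: "real vec" and g :: "nat \<Rightarrow> real vec"
  assumes c: "c \<in> carrier_vec l" and g: "\<And>j. j < n \<Longrightarrow> g j \<in> carrier_vec l"
    and "finite W" and "W \<subseteq> K" and "K \<subseteq> carrier_vec l"
    and "\<And>u v \<alpha> \<beta>. u \<in> K \<Longrightarrow> v \<in> K \<Longrightarrow> 0 \<le> \<alpha> \<Longrightarrow> 0 \<le> \<beta> \<Longrightarrow> \<alpha> \<cdot>\<^sub>v u + \<beta> \<cdot>\<^sub>v v \<in> K"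
    and "\<And>w. w \<in> K \<Longrightarrow> \<forall>j<n. w \<bullet> g j = 0 \<Longrightarrow> 0 \<le> w \<bullet> c"
  shows "\<exists>y. \<forall>w\<in>W. 0 \<le> w \<bullet> c + (\<Sum>j<n. y j * (w \<bullet> g j))"
  using g assms(3-)
proof (induction n arbitrary: W K)
  case 0
  then show ?case by auto
next
  case (Suc n)
  note fin = \<open>finite W\<close> and WK = \<open>W \<subseteq> K\<close> and KV = \<open>K \<subseteq> carrier_vec l\<close>
  note cone = Suc.prems(5) and nonneg = Suc.prems(6)
  have gn: "g n \<in> carrier_vec l" using Suc.prems(1) by simp
  define K' where "K' = {w \<in> K. w \<bullet> g n = 0}"
  define comb where
    "comb = (\<lambda>(p, q). (p \<bullet> g n) \<cdot>\<^sub>v q + (- (q \<bullet> g n)) \<cdot>\<^sub>v p)"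
  define W' where "W' = {w \<in> W. w \<bullet> g n = 0} \<union>
     comb ` ({p \<in> W. 0 < p \<bullet> g n} \<times> {q \<in> W. q \<bullet> g n < 0})"
  have lin: "(\<alpha> \<cdot>\<^sub>v u + \<beta> \<cdot>\<^sub>v v) \<bullet> h = \<alpha> * (u \<bullet> h) + \<beta> * (v \<bullet> h)"
    if "u \<in> K" "v \<in> K" "h \<in> carrier_vec l" for u v h and \<alpha> \<beta> :: real
  proof -
    have "u \<in> carrier_vec l" "v \<in> carrier_vec l" using that KV by auto
    with that show ?thesis by (simp add: add_scalar_prod_distrib[of _ l])
  qed
  have finW': "finite W'" using fin by (simp add: W'_def)
  have W'K': "W' \<subseteq> K'"
  proof
    fix w assume "w \<in> W'"
    then consider "w \<in> W" "w \<bullet> g n = 0"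
      | p q where "p \<in> W" "0 < p \<bullet> g n" "q \<in> W" "q \<bullet> g n < 0" "w = comb (p, q)"
      by (auto simp: W'_def)
    then show "w \<in> K'"
    proof cases
      case 1
      then show ?thesis using WK by (auto simp: K'_def)
    next
      case 2
      then have "p \<in> K" "q \<in> K" using WK by auto
      with 2 show ?thesis
        by (auto simp: K'_def comb_def lin gn intro!: cone)
    qed
  qed
  have "\<exists>y. \<forall>w\<in>W'. 0 \<le> w \<bullet> c + (\<Sum>j<n. y j * (w \<bullet> g j))"
  proof (rule Suc.IH[of W' K'])
    show "\<alpha> \<cdot>\<^sub>v u + \<beta> \<cdot>\<^sub>v v \<in> K'" if "u \<in> K'" "v \<in> K'" "0 \<le> \<alpha>" "0 \<le> \<beta>" for u v \<alpha> \<beta>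
      using that cone lin gn by (auto simp: K'_def)
    show "0 \<le> w \<bullet> c" if "w \<in> K'" "\<forall>j<n. w \<bullet> g j = 0" for w
      using that nonneg by (auto simp: K'_def less_Suc_eq)
  qed (use Suc.prems(1) finW' W'K' KV in \<open>auto simp: K'_def\<close>)
  then obtain y where
    y: "\<And>w. w \<in> W' \<Longrightarrow> 0 \<le> w \<bullet> c + (\<Sum>j<n. y j * (w \<bullet> g j))" by blast
  define f where "f w = w \<bullet> c + (\<Sum>j<n. y j * (w \<bullet> g j))" for w
  have f_comb: "f (comb (p, q)) = (p \<bullet> g n) * f q - (q \<bullet> g n) * f p"
    if "p \<in> K" "q \<in> K" for p q
    using that Suc.prems(1) c
    by (simp add: f_def comb_def lin algebra_simps sum.distrib sum_distrib_left sum_subtractf)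
  have "\<exists>t. \<forall>w\<in>W. 0 \<le> f w + t * (w \<bullet> g n)"
  proof (rule exists_common_solution_of_bounds[OF fin])
    show "0 \<le> f w" if "w \<in> W" "w \<bullet> g n = 0" for w
      using that y by (simp add: f_def W'_def)
    show "0 \<le> (p \<bullet> g n) * f q - (q \<bullet> g n) * f p"
      if "p \<in> W" "q \<in> W" "0 < p \<bullet> g n" "q \<bullet> g n < 0" for p q
    proof -
      have "comb (p, q) \<in> W'" using that by (auto simp: W'_def)
      then have "0 \<le> f (comb (p, q))" using y by (simp add: f_def)
      moreover have "p \<in> K" "q \<in> K" using that WK by auto
      ultimately show ?thesis using f_comb by simp
    qed
  qed
  then obtain t where t: "\<forall>w\<in>W. 0 \<le> f w + t * (w \<bullet> g n)" by blast
  have "(\<Sum>j<n. (y(n := t)) j * (w \<bullet> g j)) = (\<Sum>j<n. y j * (w \<bullet> g j))" for w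
    by (rule sum.cong) auto
  with t show ?case
    by (intro exI[of _ "y(n := t)"]) (simp add: f_def add.assoc)
qed

section \<open>Gale's theorem of the alternative\<close>

lemma nonneg_orthant_iff:
  "z \<in> nonneg_orthant l \<longleftrightarrow> z \<in> carrier_vec l \<and> (\<forall>i<l. 0 \<le> z $ i)"
  by (auto simp: nonneg_orthant_def less_eq_vec_def)

lemma scalar_prod_nonneg_orthant:
  assumes "u \<in> nonneg_orthant l" "v \<in> nonneg_orthant l"
  shows "0 \<le> u \<bullet> v"
  using assms by (auto simp: nonneg_orthant_iff scalar_prod_def intro!: sum_nonneg)

lemma mat_kernel_transpose_iff:
  fixes M :: "real mat"
  assumes "M \<in> carrier_mat l n"
  shows "z \<in> mat_kernel (transpose_mat M) \<longleftrightarrow> z \<in> carrier_vec l \<and> (\<forall>j<n. z \<bullet> col M j = 0)"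
proof -
  have "z \<bullet> col M j = col M j \<bullet> z" if "z \<in> carrier_vec l" "j < n" for j
    using assms that by (intro comm_scalar_prod[of _ l]) auto
  then show ?thesis
    using assms by (auto simp: mat_kernel_def vec_eq_iff)
qed

text \<open>
  Gale's theorem of the alternative. The system \<open>0 \<le> c + M y\<close> consists of the inequalities whose
  multipliers are the unit vectors, so solvability is elimination started from these multipliers
  inside the nonnegative orthant.
\<close>

lemma gale_alternative:
  fixes c :: "real vec" and M :: "real mat"
  assumes c: "c \<in> carrier_vec l" and M: "M \<in> carrier_mat l n"
  shows "(\<exists>y \<in> carrier_vec n. 0\<^sub>v l \<le> c + M *\<^sub>v y) \<longleftrightarrow>
    (\<forall>z \<in> mat_kernel (transpose_mat M) \<inter> nonneg_orthant l. 0 \<le> z \<bullet> c)"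
proof
  assume "\<exists>y \<in> carrier_vec n. 0\<^sub>v l \<le> c + M *\<^sub>v y"
  then obtain y where y: "y \<in> carrier_vec n" "0\<^sub>v l \<le> c + M *\<^sub>v y" by blast
  show "\<forall>z \<in> mat_kernel (transpose_mat M) \<inter> nonneg_orthant l. 0 \<le> z \<bullet> c"
  proof
    fix z assume z: "z \<in> mat_kernel (transpose_mat M) \<inter> nonneg_orthant l"
    then have zl: "z \<in> carrier_vec l" by (simp add: nonneg_orthant_def)
    have "z \<bullet> (M *\<^sub>v y) = (transpose_mat M *\<^sub>v z) \<bullet> y"
      using transpose_vec_mult_scalar[OF M y(1) zl] by simp
    also have "\<dots> = 0"
      using z M y(1) by (simp add: mat_kernel_def)
    finally have "z \<bullet> c = z \<bullet> (c + M *\<^sub>v y)"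
      using zl c M y(1) by (simp add: scalar_prod_add_distrib[of _ l])
    moreover have "c + M *\<^sub>v y \<in> nonneg_orthant l"
      using y c M by (simp add: nonneg_orthant_def)
    ultimately show "0 \<le> z \<bullet> c"
      using z scalar_prod_nonneg_orthant by auto
  qed
next
  assume dual: "\<forall>z \<in> mat_kernel (transpose_mat M) \<inter> nonneg_orthant l. 0 \<le> z \<bullet> c"
  have "\<exists>y. \<forall>w \<in> unit_vec l ` {..<l}. 0 \<le> w \<bullet> c + (\<Sum>j<n. y j * (w \<bullet> col M j))"
  proof (rule fourier_motzkin[where K = "nonneg_orthant l" and l = l])
    show "unit_vec l ` {..<l} \<subseteq> nonneg_orthant l"
      by (auto simp: nonneg_orthant_iff unit_vec_def)
    show "0 \<le> w \<bullet> c" if "w \<in> nonneg_orthant l" "\<forall>j<n. w \<bullet> col M j = 0" for w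
      using that dual M by (auto simp: mat_kernel_transpose_iff nonneg_orthant_def)
  qed (use c M in \<open>auto simp: nonneg_orthant_iff\<close>)
  then obtain y where
    y: "\<And>i. i < l \<Longrightarrow> 0 \<le> unit_vec l i \<bullet> c + (\<Sum>j<n. y j * (unit_vec l i \<bullet> col M j))"
    by auto
  have "0 \<le> (c + M *\<^sub>v vec n y) $ i" if i: "i < l" for i
  proof -
    have "(M *\<^sub>v vec n y) $ i = (\<Sum>j<n. y j * M $$ (i, j))"
      using M i by (auto simp: scalar_prod_def lessThan_atLeast0 mult.commute intro!: sum.cong)
    also have "\<dots> = (\<Sum>j<n. y j * (unit_vec l i \<bullet> col M j))"
      using M i by (intro sum.cong) (auto simp: scalar_prod_left_unit[of _ l])
    finally show ?thesis
      using y[OF i] c M i by (simp add: scalar_prod_left_unit[of _ l])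
  qed
  then show "\<exists>y \<in> carrier_vec n. 0\<^sub>v l \<le> c + M *\<^sub>v y"
    using c M by (intro bexI[of _ "vec n y"]) (auto simp: less_eq_vec_def)
qed

section \<open>Containment of projections\<close>

text \<open>
  A nonzero element of the orthant has positive coordinate sum, so dividing by that sum brings it
  into the simplex and changes neither its membership in the kernel nor the sign of its pairing
  with \<open>c\<close>.
\<close>

lemma kernel_orthant_nonneg_iff_simplex:
  fixes c :: "real vec" and M :: "real mat"
  assumes c: "c \<in> carrier_vec l" and M: "M \<in> carrier_mat l n"
  shows "(\<forall>z \<in> mat_kernel (transpose_mat M) \<inter> nonneg_orthant l. 0 \<le> z \<bullet> c) \<longleftrightarrow>
    (\<forall>z \<in> mat_kernel (transpose_mat M) \<inter> std_simplex l. 0 \<le> z \<bullet> c)"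
proof
  show "\<forall>z \<in> mat_kernel (transpose_mat M) \<inter> std_simplex l. 0 \<le> z \<bullet> c"
    if "\<forall>z \<in> mat_kernel (transpose_mat M) \<inter> nonneg_orthant l. 0 \<le> z \<bullet> c"
    using that by (auto simp: std_simplex_def nonneg_orthant_def)
next
  assume simplex: "\<forall>z \<in> mat_kernel (transpose_mat M) \<inter> std_simplex l. 0 \<le> z \<bullet> c"
  show "\<forall>z \<in> mat_kernel (transpose_mat M) \<inter> nonneg_orthant l. 0 \<le> z \<bullet> c"
  proof
    fix z assume z: "z \<in> mat_kernel (transpose_mat M) \<inter> nonneg_orthant l"
    then have zl: "z \<in> carrier_vec l" and z0: "\<And>i. i < l \<Longrightarrow> 0 \<le> z $ i"
      by (auto simp: nonneg_orthant_iff)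
    define s where "s = (\<Sum>i<l. z $ i)"
    have "0 \<le> s" using z0 by (auto simp: s_def intro: sum_nonneg)
    show "0 \<le> z \<bullet> c"
    proof (cases "s = 0")
      case True
      then have "\<forall>i<l. z $ i = 0"
        using z0 sum_nonneg_eq_0_iff[of "{..<l}" "($) z"] by (simp add: s_def)
      then have "z = 0\<^sub>v l" using zl by auto
      then show ?thesis using c by simp
    next
      case False
      with \<open>0 \<le> s\<close> have s: "0 < s" by simp
      let ?u = "(1 / s) \<cdot>\<^sub>v z"
      have "vec l (\<lambda>_. 1) \<bullet> ?u = (\<Sum>i<l. z $ i / s)"
        using zl by (auto simp: scalar_prod_def lessThan_atLeast0 intro!: sum.cong)
      also have "\<dots> = 1"
        using s by (simp add: s_def flip: sum_divide_distrib)
      finally have "?u \<in> std_simplex l"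
        using zl z0 s by (auto simp: std_simplex_def less_eq_vec_def)
      moreover have "?u \<in> mat_kernel (transpose_mat M)"
        using z zl M by (auto simp: mat_kernel_transpose_iff)
      ultimately have "0 \<le> ?u \<bullet> c" using simplex by blast
      then show ?thesis using s zl c by (simp add: zero_le_divide_iff)
    qed
  qed
qed

theorem theorem3p1:
  fixes k l d m n :: nat
    and a b :: "real vec"
    and A A' B B' :: "real mat"
  assumes "a \<in> carrier_vec k" and "A \<in> carrier_mat k d" and "A' \<in> carrier_mat k m"
    and "b \<in> carrier_vec l" and "B \<in> carrier_mat l d" and "B' \<in> carrier_mat l n"
    and "projected_polyhedron a A A' \<noteq> {}"
  shows "(projected_polyhedron a A A' \<subseteq> projected_polyhedron b B B' \<longleftrightarrow>
           (\<forall>(x, z) \<in> projected_polyhedron a A A' \<times>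
               (mat_kernel (transpose_mat B') \<inter> nonneg_orthant l). 0 \<le> z \<bullet> (b + B *\<^sub>v x)))
       \<and> (mat_kernel (transpose_mat B') \<inter> nonneg_orthant l \<noteq> {0\<^sub>v l} \<longrightarrow>
           (projected_polyhedron a A A' \<subseteq> projected_polyhedron b B B' \<longleftrightarrow>
           (\<forall>(x, z) \<in> projected_polyhedron a A A' \<times>
               (mat_kernel (transpose_mat B') \<inter> std_simplex l). 0 \<le> z \<bullet> (b + B *\<^sub>v x))))"
proof -
  let ?P = "projected_polyhedron a A A'" and ?Q = "projected_polyhedron b B B'"
  let ?N = "mat_kernel (transpose_mat B')"
  have x: "x \<in> carrier_vec d" and bx: "b + B *\<^sub>v x \<in> carrier_vec l" if "x \<in> ?P" for x
    using that assms by (auto simp: projected_polyhedron_def)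
  have Q: "x \<in> ?Q \<longleftrightarrow> (\<forall>z \<in> ?N \<inter> nonneg_orthant l. 0 \<le> z \<bullet> (b + B *\<^sub>v x))" if "x \<in> ?P" for x
    using x[OF that] assms gale_alternative[OF bx[OF that] assms(6)]
    by (simp add: projected_polyhedron_def)
  have orthant: "?P \<subseteq> ?Q \<longleftrightarrow>
      (\<forall>x\<in>?P. \<forall>z \<in> ?N \<inter> nonneg_orthant l. 0 \<le> z \<bullet> (b + B *\<^sub>v x))"
    using Q by blast
  also have "\<dots> \<longleftrightarrow> (\<forall>x\<in>?P. \<forall>z \<in> ?N \<inter> std_simplex l. 0 \<le> z \<bullet> (b + B *\<^sub>v x))"
    using kernel_orthant_nonneg_iff_simplex[OF bx assms(6)] by simp
  finally have simplex: "?P \<subseteq> ?Q \<longleftrightarrow>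
      (\<forall>x\<in>?P. \<forall>z \<in> ?N \<inter> std_simplex l. 0 \<le> z \<bullet> (b + B *\<^sub>v x))" .
  show ?thesis
    using orthant simplex by blast
qed

end
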